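(* Let $(a,b,c)=(3.4445,-4.775,2.0315)$, $p(s)=as+bs^3+cs^5$, and for $J\ge1$ let $\phi_J=p\circ\cdots\circ p$ ($J$-fold composition). Put $$\ell_J=\inf_{0<s\le1}\frac{\phi_J(s)}{s},\qquad u_J=\sup_{0<s\le1}\frac{\phi_J(s)}{s},\qquad c_J=\max_{0\le s\le1}\phi_J(s).$$ Then for every integer $J\ge1$, $$\ell_J\ge\frac{17}{25},\qquad u_J=3.4445^J,\qquad c_J\le\frac54 .$$ In particular, for $J=5$, the quantity $\bar\rho_5:=\dfrac{u_5+\ell_5}{2\sqrt{u_5\ell_5}}$ satisfies $\bar\rho_5<13.371$.
   Context: The decimal coefficients are exact rational numbers. $p$ is the scalar polynomial acting on singular values in the fixed-coefficient quintic Newton--Schulz iteration used in the Muon optimizer. *)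

theory Defs
  imports Complex_Main
begin

definition p :: "real \<Rightarrow> real" where
  "p s = 3.4445 * s + (- 4.775) * s ^ 3 + 2.0315 * s ^ 5"

definition phi :: "nat \<Rightarrow> real \<Rightarrow> real" where
  "phi J = p ^^ J"

definition ell :: "nat \<Rightarrow> real" where
  "ell J = (INF s\<in>{0<..1}. phi J s / s)"

definition u :: "nat \<Rightarrow> real" where
  "u J = (SUP s\<in>{0<..1}. phi J s / s)"

(* GREATEST is specified only when the greatest element exists, i.e. when the maximum
   is attained. *)
definition cmax :: "nat \<Rightarrow> real" where
  "cmax J = (GREATEST m. m \<in> phi J ` {0..1})"

definition rho_bar :: "nat \<Rightarrow> real" where
  "rho_bar J = (u J + ell J) / (2 * sqrt (u J * ell J))"

end

(* The interval [17/25, 5/4] is invariant under p, and below 17/25 the map p increases its argument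
   while staying at most 5/4.  Hence every iterate of s \<in> (0, 1] stays between min s (17/25) and
   5/4, which gives the bounds on ell and cmax.  On (0, 5/4] one has p x \<le> 3.4445 x, so
   phi J s / s \<le> 3.4445 ^ J, and this value is the derivative of phi J at 0.  Finally
   (u + l) / (2 sqrt (u l)) decreases in l on (0, u]. *)
theory Submission
  imports Defs
begin

lemma p_factor: "p s = s * (3.4445 - 4.775 * s^2 + 2.0315 * (s^2)^2)"
  unfolding p_def by (simp add: field_simps eval_nat_numeral)

lemma p_pos:
  assumes "0 < s"
  shows "0 < p s"
proof -
  have "0 < 3.4445 - 4.775 * t + 2.0315 * t^2" for t :: real
  proof -
    \<comment> \<open>The square is completed at the vertex; the remainder is positive because the
      discriminant is negative.\<close>
    have "3.4445 - 4.775 * t + 2.0315 * t^2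
        = 2.0315 * (t - 4.775 / 4.063)^2 + (3.4445 - 4.775^2 / 8.126)"
      by (simp add: power2_eq_square field_simps)
    also have "\<dots> > 0"
      by (intro add_nonneg_pos) (simp_all add: power2_eq_square)
    finally show ?thesis .
  qed
  with assms show ?thesis
    unfolding p_factor by (intro mult_pos_pos)
qed

lemma p_le_five_quarters:
  assumes "0 \<le> s" "s \<le> 5/4"
  shows "p s \<le> 5/4"
proof -
  \<comment> \<open>Divide by the square of \<open>s - 0.55\<close>, as \<open>p\<close> has its local maximum near 0.55.\<close>
  define q where "q = 2.0315 * (s^3 + 1.1 * s^2 + 0.9075 * s + 0.6655) - 4.775 * (s + 1.1)"
  have eq: "p s = (s - 0.55)^2 * q + p 0.55
      + (3.4445 - 3 * 4.775 * 0.55^2 + 5 * 2.0315 * 0.55^4) * (s - 0.55)"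
    unfolding p_def q_def by (simp add: field_simps eval_nat_numeral)
  \<comment> \<open>These bounds replace the cubic \<open>q\<close> by a linear majorant that
    increases in \<open>s\<close> and is still negative at 5/4.\<close>
  have s2: "s^2 \<le> 5/4 * s"
    using mult_right_mono[OF assms(2,1)] by (simp add: power2_eq_square)
  have "s^3 = s * s^2"
    by (simp add: eval_nat_numeral)
  also have "\<dots> \<le> s * (5/4 * s)"
    using s2 assms(1) by (rule mult_left_mono)
  finally have "s^3 \<le> 5/4 * s^2"
    by (simp add: power2_eq_square)
  with s2 assms have "q \<le> 0"
    unfolding q_def by simp
  then have "(s - 0.55)^2 * q \<le> 0"
    by (simp add: mult_nonneg_nonpos)
  moreover have "p 0.55 + (3.4445 - 3 * 4.775 * 0.55^2 + 5 * 2.0315 * 0.55^4) * (s - 0.55) \<le> 5/4"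
    using assms unfolding p_def by (simp add: eval_nat_numeral field_simps)
  ultimately show ?thesis
    using eq by linarith
qed

lemma p_ge_seventeen_twentyfifths:
  assumes "17/25 \<le> s" "s \<le> 5/4"
  shows "17/25 \<le> p s"
proof -
  \<comment> \<open>Divide by the square of \<open>s - 1.05\<close>, as \<open>p\<close> has its local minimum near 1.05.\<close>
  define q where "q = 2.0315 * (s^3 + 2.1 * s^2 + 3.3075 * s + 4.6305) - 4.775 * (s + 2.1)"
  have eq: "p s = (s - 1.05)^2 * q + p 1.05
      + (3.4445 - 3 * 4.775 * 1.05^2 + 5 * 2.0315 * 1.05^4) * (s - 1.05)"
    unfolding p_def q_def by (simp add: field_simps eval_nat_numeral)
  have "(17/25)^2 \<le> s^2"
    using assms by (intro power_mono) auto
  then have "0.46 \<le> s^2"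
    by (simp add: power2_eq_square)
  moreover have "(17/25)^3 \<le> s^3"
    using assms by (intro power_mono) auto
  then have "0.3 \<le> s^3"
    by (simp add: eval_nat_numeral)
  ultimately have "0 \<le> q"
    using assms(1) unfolding q_def by simp
  then have "0 \<le> (s - 1.05)^2 * q"
    by simp
  \<comment> \<open>The tangent slope is about -0.002 and \<open>p 1.05\<close> about 0.6818, so the
    tangent stays above 0.68 up to 5/4.\<close>
  moreover have "17/25 \<le> p 1.05 + (3.4445 - 3 * 4.775 * 1.05^2 + 5 * 2.0315 * 1.05^4) * (s - 1.05)"
    using assms unfolding p_def by (simp add: eval_nat_numeral field_simps)
  ultimately show ?thesis
    using eq by linarith
qed

lemma p_ge_self:
  assumes "0 \<le> s" "s \<le> 17/25"
  shows "s \<le> p s"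
proof -
  have "s^2 \<le> (17/25)^2"
    using assms by (intro power_mono) auto
  then have "1 \<le> 3.4445 - 4.775 * s^2"
    by (simp add: power2_eq_square)
  then have "1 \<le> 3.4445 - 4.775 * s^2 + 2.0315 * (s^2)^2"
    by (rule add_increasing2[rotated]) simp
  with assms show ?thesis
    unfolding p_factor by (simp add: mult_le_cancel_left1)
qed

lemma p_le_linear:
  assumes "0 \<le> s" "s \<le> 5/4"
  shows "p s \<le> 3.4445 * s"
proof -
  have "s^2 \<le> (5/4)^2"
    using assms by (intro power_mono) auto
  then have "s^2 * (2.0315 * s^2 - 4.775) \<le> 0"
    by (intro mult_nonneg_nonpos) (simp_all add: power2_eq_square)
  then have "3.4445 - 4.775 * s^2 + 2.0315 * (s^2)^2 \<le> 3.4445"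
    by (simp add: algebra_simps power2_eq_square)
  from mult_left_mono[OF this assms(1)] show ?thesis
    by (simp add: p_factor mult.commute)
qed

lemma phi_0 [simp]: "phi 0 s = s"
  and phi_Suc [simp]: "phi (Suc J) s = p (phi J s)"
  by (simp_all add: phi_def)

text \<open>The three bounds go through one induction: 5/4 keeps each iterate where the estimates on
  \<open>p\<close> apply. The minimum covers small starting points, whose iterates grow until they
  pass 17/25.\<close>

lemma phi_bounds:
  assumes "0 < s" "s \<le> 1"
  shows "min s (17/25) \<le> phi J s \<and> phi J s \<le> 5/4 \<and> phi J s \<le> 3.4445 ^ J * s"
proof (induction J)
  case 0
  then show ?case using assms by simp
next
  case (Suc J)
  let ?x = "phi J s"
  have x: "0 < ?x" "?x \<le> 5/4" "min s (17/25) \<le> ?x" "?x \<le> 3.4445 ^ J * s"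
    using Suc assms by auto
  have "min s (17/25) \<le> p ?x"
    using p_ge_self[of ?x] p_ge_seventeen_twentyfifths[of ?x] x by (cases "?x \<le> 17/25") auto
  moreover have "p ?x \<le> 5/4"
    using x by (intro p_le_five_quarters) auto
  moreover have "p ?x \<le> 3.4445 ^ Suc J * s"
    using p_le_linear[of ?x] x by simp
  ultimately show ?case by simp
qed

lemma phi_at_0 [simp]: "phi J 0 = 0"
  by (induction J) (simp_all add: p_def)

lemma phi_has_derivative_0: "(phi J has_real_derivative 3.4445 ^ J) (at 0)"
proof (induction J)
  case 0
  have "phi 0 = (\<lambda>s. s)" by (simp add: fun_eq_iff)
  then show ?case by simp
next
  case (Suc J)
  have "(p has_real_derivative 3.4445) (at (phi J 0))"
    unfolding p_def [abs_def] by (auto intro!: derivative_eq_intros)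
  from DERIV_chain2[OF this Suc] show ?case
    by (simp add: phi_def o_def)
qed

lemma continuous_on_phi: "continuous_on A (phi J)"
proof (induction J)
  case 0
  then show ?case by (simp add: phi_def id_def)
next
  case (Suc J)
  have "phi (Suc J) = (\<lambda>s. p (phi J s))"
    by (simp add: fun_eq_iff)
  with Suc show ?case
    by (auto simp: p_def intro!: continuous_intros)
qed

lemma phi_quotient_bounds:
  assumes "0 < s" "s \<le> 1"
  shows "17/25 \<le> phi J s / s" "phi J s / s \<le> 3.4445 ^ J"
proof -
  have "17/25 * s \<le> min s (17/25)"
    using assms by (auto simp: min_def)
  then show "17/25 \<le> phi J s / s" "phi J s / s \<le> 3.4445 ^ J"
    using phi_bounds[OF assms, of J] assms(1)
    by (auto simp only: pos_le_divide_eq pos_divide_le_eq)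
qed

lemma ell_ge: "17/25 \<le> ell J"
  unfolding ell_def using phi_quotient_bounds(1) by (intro cINF_greatest) auto

lemma u_eq: "u J = 3.4445 ^ J"
proof (rule antisym)
  show "u J \<le> 3.4445 ^ J"
    unfolding u_def using phi_quotient_bounds(2) by (intro cSUP_least) auto
  have bdd: "bdd_above ((\<lambda>s. phi J s / s) ` {0<..1})"
    using phi_quotient_bounds(2) by (intro bdd_aboveI2) auto
  \<comment> \<open>As \<open>phi J 0 = 0\<close>, this is the difference quotient at 0, restricted
    to the right.\<close>
  have "((\<lambda>s. phi J s / s) \<longlongrightarrow> 3.4445 ^ J) (at_right 0)"
    using phi_has_derivative_0[of J] by (auto simp: DERIV_def intro: tendsto_within_subset)
  moreover have "\<forall>\<^sub>F s in at_right 0. phi J s / s \<le> u J"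
    using eventually_at_right_less[of 0] eventually_at_right_real[of 0 1]
    by (auto simp: u_def elim!: eventually_mono intro!: cSUP_upper bdd)
  ultimately show "3.4445 ^ J \<le> u J"
    by (rule tendsto_upperbound) simp
qed

text \<open>Both are compared with the quotient at \<open>s = 1\<close>. This places
  \<open>ell 5\<close> in the interval used for the chord estimate.\<close>

lemma ell_le_u: "ell J \<le> u J"
proof -
  have "bdd_below ((\<lambda>s. phi J s / s) ` {0<..1})"
    by (rule bdd_belowI2) (auto intro!: phi_quotient_bounds(1))
  then have "ell J \<le> phi J 1 / 1"
    unfolding ell_def by (rule cINF_lower) simp
  then show ?thesis
    using phi_quotient_bounds(2)[of 1 J] by (simp add: u_eq)
qed

lemma cmax_le: "cmax J \<le> 5/4"
proof -
  \<comment> \<open>Compactness supplies a maximizer, so \<open>GREATEST\<close> denotes an actual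
    value.\<close>
  obtain x where x: "x \<in> {0..1}" "\<And>y. y \<in> {0..1} \<Longrightarrow> phi J y \<le> phi J x"
    using continuous_attains_sup[OF _ _ continuous_on_phi, of "{0..1}" J] by auto
  then have "cmax J = phi J x"
    unfolding cmax_def by (intro Greatest_equality) auto
  also have "\<dots> \<le> 5/4"
    using phi_bounds[of x J] x(1) by (cases "x = 0") auto
  finally show ?thesis .
qed

lemma rho_bar_5_less: "rho_bar 5 < 13.371"
proof -
  define l v where "l = ell 5" and "v = u 5"
  have l: "17/25 \<le> l" "l \<le> v"
    unfolding l_def v_def by (rule ell_ge, rule ell_le_u)
  have v: "v = 3.4445 ^ 5"
    by (simp add: v_def u_eq)
  \<comment> \<open>The quantity below is convex in \<open>l\<close>, so it suffices that it is negative at both ends of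
    \<open>[17/25, v]\<close>; the chord replaces \<open>l\<^sup>2\<close>.\<close>
  have "(l - 17/25) * (l - v) \<le> 0"
    using l by (intro mult_nonneg_nonpos) auto
  then have "(v + l)^2 - (2 * 13.371)^2 * (v * l)
      \<le> v^2 - 17/25 * v + (17/25 + 3 * v - (2 * 13.371)^2 * v) * l"
    by (simp add: power2_eq_square field_simps)
  \<comment> \<open>The chord has negative slope in \<open>l\<close>, so \<open>l = 17/25\<close> is
    the worst case; there the ratio is about 13.3703, which 13.371 rounds up.\<close>
  also have "\<dots> < 0"
    using l(1) unfolding v by (simp add: eval_nat_numeral)
  finally have "(v + l)^2 < (2 * 13.371 * sqrt (v * l))^2"
    using l by (simp only: power_mult_distrib) simp
  then have "v + l < 2 * 13.371 * sqrt (v * l)"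
    by (rule power2_less_imp_less) (use l in simp)
  moreover have "0 < sqrt (v * l)"
    using l by simp
  ultimately show ?thesis
    unfolding rho_bar_def l_def[symmetric] v_def[symmetric]
    by (simp add: pos_divide_less_eq)
qed

theorem mainTheorem5:
  "(\<forall>J::nat. J \<ge> 1 \<longrightarrow> ell J \<ge> 17 / 25 \<and> u J = 3.4445 ^ J \<and> cmax J \<le> 5 / 4)
   \<and> rho_bar 5 < 13.371"
  using ell_ge u_eq cmax_le rho_bar_5_less by blast

end
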